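(* Let $n\ge1$ and let $a_1,\dots,a_n,b_1,\dots,b_n$ be complex parameters of modulus strictly less than $1$. For every $\lambda\in\mathbb{Y}_n$ and every $i\in\{1,\dots,n+1\}$, setting $x_i=0$ in the polynomial $\mathsf f_\lambda(x_1,\dots,x_{n+1}|a_1,\dots,a_n;b_1,\dots,b_n)$ yields the polynomial $\mathbb{F}_\lambda$ in the remaining $n$ variables: $$\mathsf f_\lambda(x_1,\dots,x_{n+1}|a_1,\dots,a_n;b_1,\dots,b_n)\big|_{x_i=0}=\mathbb{F}_\lambda(x_1,\dots,x_{i-1},x_{i+1},\dots,x_{n+1}|a_1,\dots,a_n;b_1,\dots,b_n).$$
   Context: Let $q\in\mathbb{C}$ with $|q|<1$, and $(z;q)_k=\prod_{i=0}^{k-1}(1-zq^i)$ for $k\in\mathbb{Z}_{\ge0}$. $\mathbb{Y}_n$ is the set of integer partitions $\lambda=(\lambda_1\ge\dots\ge\lambda_n\ge0)$ with at most $n$ nonzero parts, with $\lambda_i=0$ for $i>n$ (so $\mathbb{Y}_n\subset\mathbb{Y}_{n+1}$); $|\lambda|=\sum_i\lambda_i$. For partitions, $\mu\preceq\lambda$ means $\lambda_i\ge\mu_i\ge\lambda_{i+1}$ for all $i\ge1$. Spin $q$-Whittaker polynomials: let $N\ge1$ and let $c_1,\dots,c_N,d_1,\dots,d_N$ be complex parameters of modulus $<1$. For $\lambda\in\mathbb{Y}_N$, $\mu\in\mathbb{Y}_{N-1}$ set $$\mathbb{F}_{\lambda/\mu}(x|c_1,\dots,c_N;d_1,\dots,d_N)=\mathbf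 1_{\mu\preceq\lambda}\,x^{|\lambda|-|\mu|}\prod_{r=1}^N\frac{(c_r/x;q)_{\lambda_r-\mu_r}(xd_r;q)_{\mu_r-\lambda_{r+1}}(q;q)_{\lambda_r-\lambda_{r+1}}}{(q;q)_{\lambda_r-\mu_r}(q;q)_{\mu_r-\lambda_{r+1}}(c_rd_r;q)_{\lambda_r-\lambda_{r+1}}}.$$ Define recursively, starting from $\mathbb{F}_\varnothing=1$ in zero variables, $$\mathbb{F}_\lambda(x_1,\dots,x_N|c_1,\dots,c_N;d_1,\dots,d_N)=\sum_{\mu\in\mathbb{Y}_{N-1},\,\mu\preceq\lambda}\mathbb{F}_\mu(x_1,\dots,x_{N-1}|c_2,\dots,c_N;d_1,\dots,d_{N-1})\,\mathbb{F}_{\lambda/\mu}(x_N|c_1,\dots,c_N;d_1,\dots,d_N).$$ These are polynomials, known to be symmetric in $x_1,\dots,x_N$. Set $$\mathsf f_\lambda(x_1,\dots,x_N|c_1,\dots,c_{N-1};d_1,\dots,d_{N-1})=\mathbb{F}_\lambda(x_1,\dots,x_N|c_1,\dots,c_{N-1},0;d_1,\dots,d_N),$$ which does not depend on $d_N$. *)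

theory Defs
  imports Complex_Main "HOL-Computational_Algebra.Polynomial"
begin

text \<open>
  All families are indexed from \<open>0\<close>: the mathematical \<open>x\<^sub>1, \<dots>, x\<^sub>N\<close> is
  \<open>x 0, \<dots>, x (N - 1)\<close>, and likewise for the parameters \<open>c\<close>, \<open>d\<close> and for the parts
  of a partition. Families are functions on \<open>nat\<close>, of which only an initial segment is used.
\<close>

definition qpoch :: "complex \<Rightarrow> complex \<Rightarrow> nat \<Rightarrow> complex" where
  "qpoch z q k = (\<Prod>i<k. 1 - z * q ^ i)"

definition partitions :: "nat \<Rightarrow> (nat \<Rightarrow> nat) set" where
  "partitions n = {lam. antimono lam \<and> (\<forall>i\<ge>n. lam i = 0)}"

definition psize :: "(nat \<Rightarrow> nat) \<Rightarrow> nat" where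
  "psize lam = (\<Sum>i | lam i \<noteq> 0. lam i)"

definition interlace :: "(nat \<Rightarrow> nat) \<Rightarrow> (nat \<Rightarrow> nat) \<Rightarrow> bool" where
  "interlace mu lam \<longleftrightarrow> (\<forall>i. lam (Suc i) \<le> mu i \<and> mu i \<le> lam i)"

text \<open>
  The polynomial \<open>x\<^sup>k (c/x; q)\<^sub>k\<close> in \<open>x\<close>, with the denominators cleared so that it may be
  evaluated at \<open>x = 0\<close>, where \<open>c / x\<close> is meaningless.
\<close>

definition qpoch_hom :: "complex \<Rightarrow> complex \<Rightarrow> complex \<Rightarrow> nat \<Rightarrow> complex" where
  "qpoch_hom x c q k = (\<Prod>i<k. x - c * q ^ i)"

text \<open>
  The one-variable skew function. The power \<open>x\<^bsup>|lam| - |mu|\<^esup>\<close> has been distributed over the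
  factors \<open>(c\<^sub>r/x; q)\<close>; the lemmas \<open>skew_sqW_eq\<close> and \<open>skew_sqW_polynomial\<close> below show that
  this is the polynomial that agrees with the usual formula for \<open>x \<noteq> 0\<close>.
\<close>

definition skew_sqW ::
  "complex \<Rightarrow> nat \<Rightarrow> (nat \<Rightarrow> nat) \<Rightarrow> (nat \<Rightarrow> nat) \<Rightarrow> complex
    \<Rightarrow> (nat \<Rightarrow> complex) \<Rightarrow> (nat \<Rightarrow> complex) \<Rightarrow> complex" where
  "skew_sqW q N lam mu x c d =
    (if interlace mu lam then
      (\<Prod>r<N. qpoch_hom x (c r) q (lam r - mu r) * qpoch (x * d r) q (mu r - lam (Suc r))
              * qpoch q q (lam r - lam (Suc r))
            / (qpoch q q (lam r - mu r) * qpoch q q (mu r - lam (Suc r))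
              * qpoch (c r * d r) q (lam r - lam (Suc r))))
     else 0)"

text \<open>The spin q-Whittaker polynomial in \<open>N\<close> variables, as a polynomial function of \<open>x\<close>.\<close>

primrec sqW ::
  "complex \<Rightarrow> nat \<Rightarrow> (nat \<Rightarrow> nat) \<Rightarrow> (nat \<Rightarrow> complex)
    \<Rightarrow> (nat \<Rightarrow> complex) \<Rightarrow> (nat \<Rightarrow> complex) \<Rightarrow> complex" where
  "sqW q 0 lam x c d = 1"
| "sqW q (Suc N) lam x c d =
    (\<Sum>mu | mu \<in> partitions N \<and> interlace mu lam.
      sqW q N mu x (\<lambda>r. c (Suc r)) d * skew_sqW q (Suc N) lam mu (x N) c d)"

text \<open>
  The variant in \<open>N \<ge> 1\<close> variables with \<open>N - 1\<close> parameters \<open>c\<close> and \<open>d\<close>. The last entry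
  \<open>d (N - 1)\<close> is formally passed on but irrelevant, see \<open>sqWf_indep\<close>.
\<close>

definition sqWf ::
  "complex \<Rightarrow> nat \<Rightarrow> (nat \<Rightarrow> nat) \<Rightarrow> (nat \<Rightarrow> complex)
    \<Rightarrow> (nat \<Rightarrow> complex) \<Rightarrow> (nat \<Rightarrow> complex) \<Rightarrow> complex" where
  "sqWf q N lam x c d = sqW q N lam x (c(N - 1 := 0)) d"


lemma qpoch_0 [simp]: "qpoch z q 0 = 1"
  by (simp add: qpoch_def)

lemma qpoch_zero_left [simp]: "qpoch 0 q k = 1"
  by (simp add: qpoch_def)

lemma qpoch_hom_eq:
  assumes "x \<noteq> 0"
  shows "qpoch_hom x c q k = x ^ k * qpoch (c / x) q k"
proof -
  have "qpoch_hom x c q k = (\<Prod>i<k. x * (1 - c / x * q ^ i))"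
    unfolding qpoch_hom_def using assms by (intro prod.cong) (auto simp: field_simps)
  thus ?thesis by (simp add: prod.distrib qpoch_def)
qed

lemma psize_eq:
  assumes "lam \<in> partitions n"
  shows "psize lam = (\<Sum>i<n. lam i)"
  unfolding psize_def
  by (rule sum.mono_neutral_left) (use assms in \<open>auto simp: partitions_def not_less[symmetric]\<close>)

lemma partitions_mono: "m \<le> n \<Longrightarrow> partitions m \<subseteq> partitions n"
  by (auto simp: partitions_def)

lemma finite_interlace: "finite {mu. mu \<in> partitions N \<and> interlace mu lam}"
proof (rule finite_subset)
  let ?B = "\<Sum>j<N. lam j"
  show "{mu. mu \<in> partitions N \<and> interlace mu lam} \<subseteq>
    {f. \<forall>i. (i \<in> {..<N} \<longrightarrow> f i \<in> {..?B}) \<and> (i \<notin> {..<N} \<longrightarrow> f i = 0)}"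
  proof (safe, goal_cases)
    case (1 mu i)
    have "mu i \<le> lam i" using 1 by (auto simp: interlace_def)
    also have "\<dots> \<le> ?B" using 1 by (intro member_le_sum) auto
    finally show ?case by simp
  next
    case (2 mu i)
    thus ?case by (cases "i < N") (auto simp: partitions_def)
  qed
  show "finite {f. \<forall>i. (i \<in> {..<N} \<longrightarrow> f i \<in> {..?B}) \<and> (i \<notin> {..<N} \<longrightarrow> f i = (0::nat))}"
    by (rule finite_set_of_finite_funs) auto
qed

lemma skew_sqW_eq:
  assumes "x \<noteq> 0" "lam \<in> partitions N" "mu \<in> partitions (N - 1)"
  shows "skew_sqW q N lam mu x c d =
    (if interlace mu lam then 1 else 0) * x ^ (psize lam - psize mu) *
    (\<Prod>r<N. qpoch (c r / x) q (lam r - mu r) * qpoch (x * d r) q (mu r - lam (Suc r))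
            * qpoch q q (lam r - lam (Suc r))
          / (qpoch q q (lam r - mu r) * qpoch q q (mu r - lam (Suc r))
            * qpoch (c r * d r) q (lam r - lam (Suc r))))"
proof (cases "interlace mu lam")
  case True
  have mu: "mu \<in> partitions N"
    using assms(3) partitions_mono[of "N - 1" N] by auto
  have "psize lam - psize mu = (\<Sum>r<N. lam r - mu r)"
    using True unfolding psize_eq[OF assms(2)] psize_eq[OF mu]
    by (subst sum_subtractf_nat) (auto simp: interlace_def)
  hence "x ^ (psize lam - psize mu) = (\<Prod>r<N. x ^ (lam r - mu r))"
    by (simp add: power_sum)
  thus ?thesis
    using True by (simp add: skew_sqW_def qpoch_hom_eq[OF assms(1)] prod.distrib[symmetric] mult.assoc)
next
  case False
  thus ?thesis by (simp add: skew_sqW_def)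
qed

lemma skew_sqW_polynomial: "\<exists>p. \<forall>x. skew_sqW q N lam mu x c d = poly p x"
proof (cases "interlace mu lam")
  case True
  define p where "p =
    (\<Prod>r<N. smult (qpoch q q (lam r - lam (Suc r))
            / (qpoch q q (lam r - mu r) * qpoch q q (mu r - lam (Suc r))
              * qpoch (c r * d r) q (lam r - lam (Suc r))))
        ((\<Prod>i<lam r - mu r. [:- (c r * q ^ i), 1:]) *
         (\<Prod>i<mu r - lam (Suc r). [:1, - (d r * q ^ i):])))"
  have "skew_sqW q N lam mu x c d = poly p x" for x
    using True
    by (auto simp: skew_sqW_def p_def poly_prod qpoch_hom_def qpoch_def[of "x * _"] mult_ac
        intro!: prod.cong)
  thus ?thesis by blast
next
  case False
  thus ?thesis by (intro exI[of _ 0]) (simp add: skew_sqW_def)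
qed

lemma sqW_cong:
  assumes "\<And>r. r < N \<Longrightarrow> x r = x' r" "\<And>r. r < N \<Longrightarrow> c r = c' r" "\<And>r. r < N \<Longrightarrow> d r = d' r"
  shows "sqW q N lam x c d = sqW q N lam x' c' d'"
  using assms
proof (induction N arbitrary: lam c c')
  case (Suc N)
  have "sqW q N mu x (\<lambda>r. c (Suc r)) d = sqW q N mu x' (\<lambda>r. c' (Suc r)) d'" for mu
    by (rule Suc.IH) (use Suc.prems in auto)
  moreover have "skew_sqW q (Suc N) lam mu (x N) c d = skew_sqW q (Suc N) lam mu (x' N) c' d'" for mu
    unfolding skew_sqW_def by (auto simp: Suc.prems intro!: prod.cong)
  ultimately show ?case by simp
qed simp

lemma sqWf_indep:
  assumes lam: "lam \<in> partitions N"
    and c: "\<And>r. r < N - 1 \<Longrightarrow> c r = c' r" and d: "\<And>r. r < N - 1 \<Longrightarrow> d r = d' r"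
  shows "sqWf q N lam x c d = sqWf q N lam x c' d'"
proof (cases N)
  case 0
  thus ?thesis by (simp add: sqWf_def)
next
  case (Suc M)
  have 1: "sqW q M mu x (\<lambda>r. (c(M := 0)) (Suc r)) d = sqW q M mu x (\<lambda>r. (c'(M := 0)) (Suc r)) d'" for mu
    by (rule sqW_cong) (use c d Suc in auto)
  have 2: "skew_sqW q (Suc M) lam mu y (c(M := 0)) d = skew_sqW q (Suc M) lam mu y (c'(M := 0)) d'"
    if "mu \<in> partitions M" for mu y
  proof -
    have "mu M = 0" using that by (simp add: partitions_def)
    thus ?thesis
      unfolding skew_sqW_def using c d Suc by (auto intro!: prod.cong)
  qed
  show ?thesis
    unfolding sqWf_def Suc sqW.simps using 1 2 by (auto intro!: sum.cong)
qed

end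

theory Submission
  imports Defs
begin

text \<open>
  Write \<open>H\<^sub>k(x, c) = (x - c)(x - cq)\<dots>(x - cq\<^bsup>k-1\<^esup>)\<close> for \<open>qpoch_hom x c q k\<close>, and consider
  \<open>sqW\<close> in \<open>n + 1\<close> variables whose last parameter \<open>c\<close> is \<open>0\<close>. Two different mechanisms are at work,
  depending on which variable is set to zero.

  If \<open>lam\<close> has all its \<open>n + 1\<close> parts nonzero, the polynomial vanishes at \<open>x\<^sub>i = 0\<close> for every \<open>i\<close>
  (\<open>sqW_eq_0\<close>): the last column of the branching rule contributes \<open>H\<^sub>k(x, 0) = x\<^sup>k\<close>, where \<open>k\<close> is
  the last part, and interlacing keeps the last part positive all the way down. Hence, if the zero
  variable is not the last one, only those \<open>mu\<close> survive in the branching rule for which induction on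
  the number of variables applies, and the skew factor for the last variable is unchanged.

  If the zero variable is the last one, the branching rule applies the operator with kernel
  \<open>skew_sqW\<close> at \<open>x = 0\<close>, and it has to be moved past the operator of the preceding variable.
  This is the instance \<open>y = 0\<close> of the symmetry in two adjacent variables, and only this instance is
  proved (\<open>skew_exchange\<close>). After the exchange the zero variable is the last one of a polynomial in
  one variable fewer, and induction finishes the proof (\<open>sqW_last_zero\<close>).

  The exchange relation is a Yang--Baxter argument. For fixed outer partitions \<open>kap\<close>, \<open>lam\<close>, the
  sum over the intermediate partition \<open>nu\<close> is a product of transfer matrices along the columns: the
  state at column \<open>r\<close> is \<open>j = lam r - nu r\<close>, which ranges over \<open>0, \<dots>, lam r - kap r\<close>, and
  consecutive columns interact only through \<open>nu r - nu (r + 1)\<close>. The transfer matrices of the two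
  orders are intertwined by
  \<open>R(j, k) = [k choose j]\<^sub>q H\<^sub>j(x, c\<^sub>r) H\<^bsub>k-j\<^esub>(0, x)\<close>
  after the factor \<open>H\<^sub>k(0, c\<^sub>r)\<close> is split off from the order in which \<open>0\<close> comes first; the columns of
  \<open>R\<close> sum to this same factor, so that the two total sums agree. The local relation is
  \<open>column_exchange\<close>. Both of its sides are terminating 3-phi-2 series. Expanding a \<open>q\<close>-binomial by
  the \<open>q\<close>-Vandermonde identity and summing by the \<open>q\<close>-Chu--Vandermonde identity brings them to the
  same single sum.
\<close>

section \<open>\<open>q\<close>-shifted factorials and \<open>q\<close>-binomial coefficients\<close>

lemma qpoch_Suc: "qpoch z q (Suc k) = qpoch z q k * (1 - z * q ^ k)"
  by (simp add: qpoch_def)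

lemma qpoch_add: "qpoch z q (j + k) = qpoch z q j * qpoch (z * q ^ j) q k"
  by (induction k) (simp_all add: qpoch_Suc power_add mult_ac)

lemma qpoch_hom_0 [simp]: "qpoch_hom x c q 0 = 1"
  by (simp add: qpoch_hom_def)

lemma qpoch_hom_Suc: "qpoch_hom x c q (Suc k) = qpoch_hom x c q k * (x - c * q ^ k)"
  by (simp add: qpoch_hom_def)

lemma qpoch_hom_add: "qpoch_hom x c q (j + k) = qpoch_hom x c q j * qpoch_hom x (c * q ^ j) q k"
  by (induction k) (simp_all add: qpoch_hom_Suc power_add mult_ac)

lemma qpoch_hom_Suc': "qpoch_hom x c q (Suc k) = (x - c) * qpoch_hom x (c * q) q k"
  using qpoch_hom_add[of x c q 1 k] by (simp add: qpoch_hom_Suc)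

lemma qpoch_Suc': "qpoch z q (Suc k) = (1 - z) * qpoch (z * q) q k"
  using qpoch_add[of z q 1 k] by (simp add: qpoch_Suc)

lemma qpoch_hom_zero_scale: "qpoch_hom 0 (c * q) q k = q ^ k * qpoch_hom 0 c q k"
  by (induction k) (simp_all add: qpoch_hom_Suc)

lemma qpoch_hom_zero_zero: "k > 0 \<Longrightarrow> qpoch_hom 0 0 q k = 0"
  by (cases k) (simp_all add: qpoch_hom_Suc)

lemma qpoch_nonzero:
  assumes "norm q < 1" "norm z < 1"
  shows "qpoch z q k \<noteq> 0"
proof -
  have "1 - z * q ^ i \<noteq> 0" for i
  proof -
    have "norm (z * q ^ i) \<le> norm z * 1"
      unfolding norm_mult norm_power using assms
      by (intro mult_left_mono power_le_one) auto
    hence "z * q ^ i \<noteq> 1" using assms by (metis mult.right_neutral norm_one not_le)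
    thus ?thesis by auto
  qed
  thus ?thesis by (simp add: qpoch_def)
qed

definition qbinom :: "complex \<Rightarrow> nat \<Rightarrow> nat \<Rightarrow> complex" where
  "qbinom q n k = (if k \<le> n then qpoch q q n / (qpoch q q k * qpoch q q (n - k)) else 0)"

lemma qbinom_eq_0 [simp]: "n < k \<Longrightarrow> qbinom q n k = 0"
  by (simp add: qbinom_def)

context
  fixes q :: complex
  assumes q: "norm q < 1"
begin

lemma qfact_nonzero [simp]: "qpoch q q k \<noteq> 0"
  using q by (rule qpoch_nonzero) (rule q)

lemma qbinom_0 [simp]: "qbinom q n 0 = 1"
  by (simp add: qbinom_def)

lemma qbinom_self [simp]: "qbinom q n n = 1"
  by (simp add: qbinom_def)

lemma qbinom_Suc:
  "qbinom q (Suc n) (Suc k) = qbinom q n (Suc k) * q ^ Suc k + qbinom q n k"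
proof -
  consider "k < n" | "k = n" | "k > n" by linarith
  thus ?thesis
  proof cases
    case 1
    then obtain m where m: "n = Suc (k + m)" using less_imp_Suc_add by blast
    show ?thesis
      using qfact_nonzero[of "Suc m"] qfact_nonzero[of "Suc k"]
      unfolding m by (simp add: qbinom_def qpoch_Suc divide_simps) (simp add: algebra_simps power_add)
  qed auto
qed

lemma qbinom_Suc':
  "qbinom q (Suc n) (Suc k) = qbinom q n (Suc k) + q ^ (n - k) * qbinom q n k"
proof -
  consider "k < n" | "k = n" | "k > n" by linarith
  thus ?thesis
  proof cases
    case 1
    then obtain m where m: "n = Suc (k + m)" using less_imp_Suc_add by blast
    show ?thesis
      using qfact_nonzero[of "Suc m"] qfact_nonzero[of "Suc k"]
      unfolding m by (simp add: qbinom_def qpoch_Suc divide_simps) (simp add: algebra_simps power_add)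
  qed auto
qed

lemma qbinom_mult_qbinom:
  assumes "p \<le> l" "l \<le> m"
  shows "qbinom q m l * qbinom q l p = qbinom q m p * qbinom q (m - p) (l - p)"
  using assms by (simp add: qbinom_def)

section \<open>Two summation formulas and the local exchange relation\<close>

text \<open>
  Among the equivalent forms of this identity, this one has a power of \<open>q\<close> that does not involve
  \<open>l\<close>. It therefore expands \<open>[J + l choose t]\<^sub>q\<close> as a combination of the functions
  \<open>l \<mapsto> [l choose p]\<^sub>q\<close> with coefficients that can be pulled out of a sum over \<open>l\<close>. The truncated
  subtraction in the exponent is harmless: for \<open>J + p < t\<close> the factor \<open>[J choose t - p]\<^sub>q\<close> is \<open>0\<close>.
\<close>

lemma q_Vandermonde:
  "qbinom q (J + l) t = (\<Sum>p\<le>t. qbinom q l p * qbinom q J (t - p) * q ^ (p * (J + p - t)))"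
proof (induction l arbitrary: t)
  case 0
  have "(\<Sum>p\<le>t. qbinom q 0 p * qbinom q J (t - p) * q ^ (p * (J + p - t)))
      = (\<Sum>p\<in>{0}. qbinom q 0 p * qbinom q J (t - p) * q ^ (p * (J + p - t)))"
    by (rule sum.mono_neutral_right) auto
  thus ?case by simp
next
  case (Suc l)
  show ?case
  proof (cases t)
    case (Suc u)
    let ?f = "\<lambda>p. qbinom q l p * qbinom q J (t - p) * q ^ (p * (J + p - t))"
    let ?g = "\<lambda>p. qbinom q l p * qbinom q J (u - p) * q ^ (p * (J + p - u))"
    have step: "qbinom q (Suc l) (Suc p) * qbinom q J (t - Suc p) * q ^ (Suc p * (J + Suc p - t))
        = ?f (Suc p) + q ^ (J + l - u) * ?g p" for p
    proof (cases "p \<le> l \<and> u \<le> J + p")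
      case True
      then obtain d e where d: "l = p + d" and e: "J + p = u + e" using le_Suc_ex by blast
      have "J + l - u = d + e" using d e by simp
      moreover have "J + p - u = e" using e by simp
      ultimately show ?thesis
        by (simp add: qbinom_Suc' Suc d algebra_simps power_add)
    next
      case False
      hence "qbinom q l p = 0 \<and> qbinom q (Suc l) (Suc p) = 0 \<and> qbinom q l (Suc p) = 0
          \<or> qbinom q J (u - p) = 0" by auto
      thus ?thesis by (auto simp: Suc)
    qed
    have "(\<Sum>p\<le>t. qbinom q (Suc l) p * qbinom q J (t - p) * q ^ (p * (J + p - t)))
        = ?f 0 + (\<Sum>p\<le>u. qbinom q (Suc l) (Suc p) * qbinom q J (t - Suc p)
            * q ^ (Suc p * (J + Suc p - t)))"
      unfolding Suc sum.atMost_Suc_shift by simp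
    also have "\<dots> = ?f 0 + (\<Sum>p\<le>u. ?f (Suc p) + q ^ (J + l - u) * ?g p)"
      by (simp only: step)
    also have "\<dots> = (\<Sum>p\<le>t. ?f p) + q ^ (J + l - u) * (\<Sum>p\<le>u. ?g p)"
      unfolding Suc sum.atMost_Suc_shift by (simp add: sum.distrib sum_distrib_left)
    also have "\<dots> = qbinom q (J + l) t + q ^ (J + l - u) * qbinom q (J + l) u"
      by (simp add: Suc.IH)
    also have "\<dots> = qbinom q (J + Suc l) t"
      by (simp add: Suc qbinom_Suc')
    finally show ?thesis ..
  qed simp
qed

text \<open>
  By Pascal's rule the left-hand side \<open>F(M, g)\<close> satisfies
  \<open>F(M + 1, g) = - x q\<^sup>M F(M, g) + (x - g)/(1 - g b) F(M, g q)\<close>,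
  and so does the right-hand side. The product \<open>g b\<close> rather than a free denominator parameter is used
  so that neither \<open>g\<close> nor \<open>x\<close> needs to be inverted.
\<close>

lemma q_Chu_Vandermonde:
  assumes "\<And>k. qpoch (g * b) q k \<noteq> 0"
  shows "(\<Sum>l\<le>M. qbinom q M l * qpoch_hom x g q l * qpoch_hom 0 x q (M - l) / qpoch (g * b) q l)
    = qpoch_hom 0 g q M * qpoch (x * b) q M / qpoch (g * b) q M"
  using assms
proof (induction M arbitrary: g)
  case (Suc M)
  let ?F = "\<lambda>M g l. qbinom q M l * qpoch_hom x g q l * qpoch_hom 0 x q (M - l) / qpoch (g * b) q l"
  have nz: "qpoch (g * b) q k \<noteq> 0" for k by (rule Suc.prems)
  have nz1: "1 - g * b \<noteq> 0" using nz[of 1] by (simp add: qpoch_Suc)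
  have nz2: "qpoch (g * q * b) q k \<noteq> 0" for k
    using nz[of "Suc k"] by (simp add: qpoch_Suc' mult_ac)
  have A: "?F (Suc M) g (Suc l) = - x * q ^ M * ?F M g (Suc l) + (x - g) / (1 - g * b) * ?F M (g * q) l"
    if "l \<le> M" for l
  proof -
    have "?F M g (Suc l) * (- x * q ^ M) =
        qbinom q M (Suc l) * q ^ Suc l * qpoch_hom x g q (Suc l) * qpoch_hom 0 x q (M - l) / qpoch (g * b) q (Suc l)"
    proof (cases "l < M")
      case True
      then obtain d where "M = Suc (l + d)" using less_imp_Suc_add by blast
      thus ?thesis by (simp add: qpoch_hom_Suc power_add)
    qed auto
    moreover have "(x - g) / (1 - g * b) * ?F M (g * q) l =
        qbinom q M l * qpoch_hom x g q (Suc l) * qpoch_hom 0 x q (M - l) / qpoch (g * b) q (Suc l)"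
      by (simp add: qpoch_hom_Suc' qpoch_Suc' mult_ac)
    ultimately show ?thesis
      by (simp add: qbinom_Suc ring_distribs add_divide_distrib mult_ac)
  qed
  have B: "?F (Suc M) g 0 = - x * q ^ M * ?F M g 0"
    by (simp add: qpoch_hom_Suc)
  have "(\<Sum>l\<le>Suc M. ?F (Suc M) g l) = ?F (Suc M) g 0 + (\<Sum>l\<le>M. ?F (Suc M) g (Suc l))"
    by (rule sum.atMost_Suc_shift)
  also have "\<dots> = - x * q ^ M * ?F M g 0
      + (\<Sum>l\<le>M. - x * q ^ M * ?F M g (Suc l) + (x - g) / (1 - g * b) * ?F M (g * q) l)"
    unfolding B by (intro arg_cong2[of _ _ _ _ "(+)"] refl sum.cong A) auto
  also have "\<dots> = - x * q ^ M * (\<Sum>l\<le>Suc M. ?F M g l) + (x - g) / (1 - g * b) * (\<Sum>l\<le>M. ?F M (g * q) l)"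
    unfolding sum.atMost_Suc_shift by (simp only: sum.distrib sum_distrib_left distrib_left add.assoc)
  also have "(\<Sum>l\<le>Suc M. ?F M g l) = (\<Sum>l\<le>M. ?F M g l)"
    by simp
  also have "\<dots> = qpoch_hom 0 g q M * qpoch (x * b) q M / qpoch (g * b) q M"
    by (rule Suc.IH) (rule nz)
  also have "(\<Sum>l\<le>M. ?F M (g * q) l) = qpoch_hom 0 (g * q) q M * qpoch (x * b) q M / qpoch (g * q * b) q M"
    by (rule Suc.IH) (rule nz2)
  also have "- x * q ^ M * (qpoch_hom 0 g q M * qpoch (x * b) q M / qpoch (g * b) q M) +
      (x - g) / (1 - g * b) * (qpoch_hom 0 (g * q) q M * qpoch (x * b) q M / qpoch (g * q * b) q M)
      = qpoch_hom 0 g q M * qpoch (x * b) q M * q ^ M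
        * ((x - g) / qpoch (g * b) q (Suc M) - x / qpoch (g * b) q M)"
    by (simp add: qpoch_Suc' qpoch_hom_zero_scale algebra_simps)
  also have "(x - g) / qpoch (g * b) q (Suc M) - x / qpoch (g * b) q M
      = - g * (1 - x * b * q ^ M) / qpoch (g * b) q (Suc M)"
    using nz[of "Suc M"] nz[of M] by (simp add: qpoch_Suc field_simps)
  finally show ?case by (simp add: qpoch_hom_Suc qpoch_Suc mult_ac)
qed simp

text \<open>
  The factor \<open>[m choose l]\<^sub>q [l choose p]\<^sub>q = [m choose p]\<^sub>q [m-p choose l-p]\<^sub>q\<close> shifts the
  summation index by \<open>p\<close>, which turns the sum into a \<open>q\<close>-Chu--Vandermonde sum with \<open>c\<close> replaced by
  \<open>c q\<^sup>p\<close> and \<open>b\<close> by \<open>b q\<^sup>J\<close>.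
\<close>

lemma shifted_sum:
  assumes nz: "\<And>k. qpoch (c * b) q k \<noteq> 0"
  shows "qpoch (x * b) q J * (\<Sum>l\<le>m. qbinom q m l * qbinom q l p *
      qpoch_hom x c q l * qpoch_hom 0 x q (m - l) / qpoch (c * b) q (J + l))
    = qbinom q m p * qpoch_hom x c q p * qpoch_hom 0 (c * q ^ p) q (m - p) *
      qpoch (x * b) q (J + m - p) / qpoch (c * b) q (J + m)"
proof (cases "p \<le> m")
  case True
  then obtain M where M: "m = p + M" using le_Suc_ex by blast
  let ?f = "\<lambda>l. qbinom q m l * qbinom q l p *
      qpoch_hom x c q l * qpoch_hom 0 x q (m - l) / qpoch (c * b) q (J + l)"
  let ?g = "c * q ^ p" and ?b = "b * q ^ J"
  have split: "qpoch (c * b) q (J + p + k) = qpoch (c * b) q (J + p) * qpoch (?g * ?b) q k" for k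
    using qpoch_add[of "c * b" q "J + p" k] by (simp add: power_add mult_ac)
  have nz': "qpoch (?g * ?b) q k \<noteq> 0" for k
    using nz[of "J + p + k"] unfolding split by simp
  have "(\<Sum>l\<le>m. ?f l) = (\<Sum>l\<in>{p..m}. ?f l)"
    by (rule sum.mono_neutral_right) auto
  also have "\<dots> = (\<Sum>l\<le>M. ?f (l + p))"
    using sum.shift_bounds_cl_nat_ivl[of ?f 0 p M] by (simp add: M add.commute atLeast0AtMost)
  also have "\<dots> = (\<Sum>l\<le>M. qbinom q m p * qpoch_hom x c q p / qpoch (c * b) q (J + p) *
      (qbinom q M l * qpoch_hom x ?g q l * qpoch_hom 0 x q (M - l) / qpoch (?g * ?b) q l))"
  proof (rule sum.cong[OF refl])
    fix l assume "l \<in> {..M}"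
    hence "qbinom q m (l + p) * qbinom q (l + p) p = qbinom q m p * qbinom q M l"
      using qbinom_mult_qbinom[of p "l + p" m] by (simp add: M)
    moreover have "m - (l + p) = M - l" by (simp add: M)
    moreover have "qpoch_hom x c q (l + p) = qpoch_hom x c q p * qpoch_hom x ?g q l"
      using qpoch_hom_add[of x c q p l] by (simp add: add.commute)
    moreover have "qpoch (c * b) q (J + (l + p)) = qpoch (c * b) q (J + p) * qpoch (?g * ?b) q l"
      using split[of l] by (simp add: add_ac)
    ultimately show "?f (l + p) = qbinom q m p * qpoch_hom x c q p / qpoch (c * b) q (J + p) *
      (qbinom q M l * qpoch_hom x ?g q l * qpoch_hom 0 x q (M - l) / qpoch (?g * ?b) q l)"
      by (simp add: mult_ac)
  qed
  also have "\<dots> = qbinom q m p * qpoch_hom x c q p / qpoch (c * b) q (J + p) *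
      (qpoch_hom 0 ?g q M * qpoch (x * ?b) q M / qpoch (?g * ?b) q M)"
    unfolding sum_distrib_left[symmetric] q_Chu_Vandermonde[OF nz'] ..
  finally show ?thesis
    using split[of M] qpoch_add[of "x * b" q J M] by (simp add: M add_ac mult_ac)
qed (auto intro!: sum.neutral simp: not_le)

text \<open>
  This is the left-hand side of the local exchange relation. Up to \<open>q\<close>-factorials the right-hand side
  is the same expression with \<open>t\<close>, \<open>m\<close> exchanged and \<open>J\<close> replaced by \<open>J + m - t\<close>, so that the relation
  becomes a symmetry of this function.
\<close>

definition "exchange_sum J t m x c b =
   qpoch (x * b) q J * qpoch_hom 0 c q t *
     (\<Sum>l\<le>m. qbinom q m l * qbinom q (J + l) t *
        qpoch_hom x c q l * qpoch_hom 0 x q (m - l) / qpoch (c * b) q (J + l))"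

lemma exchange_sum_expand:
  assumes nz: "\<And>k. qpoch (c * b) q k \<noteq> 0"
  shows "exchange_sum J t m x c b = qpoch_hom 0 c q t * (\<Sum>p\<le>t.
      qbinom q J (t - p) * qbinom q m p * q ^ (p * (J + p - t)) * qpoch_hom x c q p *
      qpoch_hom 0 (c * q ^ p) q (m - p) * qpoch (x * b) q (J + m - p) / qpoch (c * b) q (J + m))"
proof -
  let ?X = "\<lambda>l. qpoch_hom x c q l * qpoch_hom 0 x q (m - l) / qpoch (c * b) q (J + l)"
  let ?a = "\<lambda>p. qbinom q J (t - p) * q ^ (p * (J + p - t))"
  have "exchange_sum J t m x c b = qpoch_hom 0 c q t * (qpoch (x * b) q J *
      (\<Sum>l\<le>m. \<Sum>p\<le>t. ?a p * (qbinom q m l * qbinom q l p * ?X l)))"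
    by (simp add: exchange_sum_def q_Vandermonde sum_distrib_left sum_distrib_right
        sum_divide_distrib mult_ac)
  also have "(\<Sum>l\<le>m. \<Sum>p\<le>t. ?a p * (qbinom q m l * qbinom q l p * ?X l))
      = (\<Sum>p\<le>t. ?a p * (\<Sum>l\<le>m. qbinom q m l * qbinom q l p * ?X l))"
    by (subst sum.swap) (simp add: sum_distrib_left)
  also have "qpoch (x * b) q J * \<dots> = (\<Sum>p\<le>t. ?a p * (qpoch (x * b) q J *
      (\<Sum>l\<le>m. qbinom q m l * qbinom q l p * qpoch_hom x c q l * qpoch_hom 0 x q (m - l) / qpoch (c * b) q (J + l))))"
    by (simp add: sum_distrib_left mult_ac)
  finally show ?thesis
    unfolding shifted_sum[OF nz] by (simp add: mult_ac)
qed

text \<open>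
  In the single-sum form the symmetry holds term by term: the products of \<open>q\<close>-binomials differ by the
  stated \<open>q\<close>-factorials, and \<open>H\<^sub>t(0, c) H\<^bsub>m-p\<^esub>(0, c q\<^sup>p)\<close> is symmetric in \<open>t\<close> and \<open>m\<close> because
  \<open>H\<^sub>t(0, c) = H\<^sub>p(0, c) H\<^bsub>t-p\<^esub>(0, c q\<^sup>p)\<close>.
\<close>

lemma exchange_sum_symmetric:
  assumes nz: "\<And>k. qpoch (c * b) q k \<noteq> 0" and JJ: "J + m = J' + t"
  shows "qpoch q q J' * qpoch q q t * exchange_sum J t m x c b
    = qpoch q q J * qpoch q q m * exchange_sum J' m t x c b"
proof -
  let ?T = "\<lambda>J t m p. qbinom q J (t - p) * qbinom q m p * q ^ (p * (J + p - t)) * qpoch_hom x c q p *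
      qpoch_hom 0 (c * q ^ p) q (m - p) * qpoch (x * b) q (J + m - p) / qpoch (c * b) q (J + m)"
  have restrict: "(\<Sum>p\<le>t. ?T J t m p) = (\<Sum>p\<le>min t m. ?T J t m p)" for J t m
    by (rule sum.mono_neutral_right) auto
  have "qpoch q q J' * qpoch q q t * qpoch_hom 0 c q t * ?T J t m p
      = qpoch q q J * qpoch q q m * qpoch_hom 0 c q m * ?T J' m t p" if p: "p \<le> min t m" for p
  proof (cases "t \<le> J + p")
    case True
    have 1: "qpoch q q J' * qpoch q q t * (qbinom q J (t - p) * qbinom q m p)
        = qpoch q q J * qpoch q q m * (qbinom q J' (m - p) * qbinom q t p)"
    proof -
      have "J - (t - p) = J' - (m - p)" "t - p \<le> J" "m - p \<le> J'" using JJ True p by auto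
      thus ?thesis using p by (simp add: qbinom_def mult_ac)
    qed
    have 2: "J + p - t = J' + p - m" using JJ True p by auto
    have split: "qpoch_hom 0 c q k = qpoch_hom 0 c q p * qpoch_hom 0 (c * q ^ p) q (k - p)" if "p \<le> k" for k
      using qpoch_hom_add[of 0 c q p "k - p"] that by simp
    have 3: "qpoch_hom 0 c q t * qpoch_hom 0 (c * q ^ p) q (m - p)
        = qpoch_hom 0 c q m * qpoch_hom 0 (c * q ^ p) q (t - p)"
      using split[of t] split[of m] p by simp
    have "qpoch q q J' * qpoch q q t * qpoch_hom 0 c q t * ?T J t m p =
      (qpoch q q J' * qpoch q q t * (qbinom q J (t - p) * qbinom q m p)) *
      (qpoch_hom 0 c q t * qpoch_hom 0 (c * q ^ p) q (m - p)) *
      (q ^ (p * (J + p - t)) * qpoch_hom x c q p * qpoch (x * b) q (J + m - p) / qpoch (c * b) q (J + m))"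
      by (simp add: mult_ac)
    also have "\<dots> = qpoch q q J * qpoch q q m * qpoch_hom 0 c q m * ?T J' m t p"
      unfolding 1 2 3 JJ by (simp add: mult_ac)
    finally show ?thesis .
  next
    case False
    thus ?thesis using JJ p by (simp add: not_le)
  qed
  hence "(\<Sum>p\<le>min t m. qpoch q q J' * qpoch q q t * qpoch_hom 0 c q t * ?T J t m p)
    = (\<Sum>p\<le>min m t. qpoch q q J * qpoch q q m * qpoch_hom 0 c q m * ?T J' m t p)"
    by (intro sum.cong) auto
  thus ?thesis
    unfolding exchange_sum_expand[OF nz] restrict
    by (simp only: sum_distrib_left mult.assoc)
qed

text \<open>
  The local relation behind the exchange of a variable \<open>x\<close> with a variable \<open>0\<close>. In one column, \<open>J\<close>
  and \<open>t\<close> are what remains of the column gap and of the total displacement once the state of the column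
  is subtracted, and \<open>m\<close> is the state of the next column. The right-hand side is summed in reverse
  order, \<open>l = t - k\<close>, to recognise it as an instance of \<open>exchange_sum\<close>.
\<close>

lemma column_exchange:
  assumes nz: "\<And>k. qpoch (c * b) q k \<noteq> 0"
  shows "qpoch (x * b) q J * qpoch_hom 0 c q t *
     (\<Sum>l\<le>m. qbinom q m l * qbinom q (J + l) t *
        qpoch_hom x c q l * qpoch_hom 0 x q (m - l) / qpoch (c * b) q (J + l))
    = qpoch_hom 0 c q m * qpoch (x * b) q (J + m - t) *
     (\<Sum>k\<le>t. qbinom q J k * qbinom q (J - k + m) (t - k) *
        qpoch_hom x c q (t - k) * qpoch_hom 0 x q k / qpoch (c * b) q (J - k + m))"
proof (cases "t \<le> J + m")
  case True
  define J' where "J' = J + m - t"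
  have JJ: "J + m = J' + t" using True by (simp add: J'_def)
  let ?S = "\<Sum>k\<le>t. qbinom q J k * qbinom q (J - k + m) (t - k) *
        qpoch_hom x c q (t - k) * qpoch_hom 0 x q k / qpoch (c * b) q (J - k + m)"
  have "qpoch q q J * qpoch q q m * exchange_sum J' m t x c b
      = qpoch q q J' * qpoch q q t * (qpoch_hom 0 c q m * qpoch (x * b) q J' * ?S)"
  proof -
    have "qpoch q q J * qpoch q q m *
        (qbinom q t (t - k) * qbinom q (J' + (t - k)) m *
        qpoch_hom x c q (t - k) * qpoch_hom 0 x q (t - (t - k)) / qpoch (c * b) q (J' + (t - k)))
      = qpoch q q J' * qpoch q q t * (qbinom q J k * qbinom q (J - k + m) (t - k) *
        qpoch_hom x c q (t - k) * qpoch_hom 0 x q k / qpoch (c * b) q (J - k + m))"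
      if "k \<le> t" for k
    proof (cases "k \<le> J")
      case True
      have e: "J' + (t - k) = J - k + m" "t - (t - k) = k" using JJ True that by auto
      have "J - k + m - (t - k) = J'" "t - k \<le> J - k + m" "m \<le> J + m - k"
        using JJ True that by auto
      hence "qpoch q q J * qpoch q q m * (qbinom q t (t - k) * qbinom q (J - k + m) m)
        = qpoch q q J' * qpoch q q t * (qbinom q J k * qbinom q (J - k + m) (t - k))"
        using True that by (simp add: qbinom_def mult_ac)
      thus ?thesis unfolding e by (simp add: divide_inverse) (metis (no_types) mult.assoc)
    next
      case False
      hence "J' + (t - k) < m" using JJ that by auto
      thus ?thesis using False by simp
    qed
    hence *: "qpoch q q J * qpoch q q m * (\<Sum>k\<le>t.
        qbinom q t (t - k) * qbinom q (J' + (t - k)) m *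
        qpoch_hom x c q (t - k) * qpoch_hom 0 x q (t - (t - k)) / qpoch (c * b) q (J' + (t - k)))
      = qpoch q q J' * qpoch q q t * ?S" (is "_ * ?Y = _")
      unfolding sum_distrib_left by (intro sum.cong) auto
    have "exchange_sum J' m t x c b = qpoch (x * b) q J' * qpoch_hom 0 c q m * ?Y"
      unfolding exchange_sum_def
      by (subst sum.atLeastAtMost_rev[where n = 0, unfolded atLeast0AtMost]) simp
    hence "qpoch q q J * qpoch q q m * exchange_sum J' m t x c b
        = qpoch (x * b) q J' * qpoch_hom 0 c q m * (qpoch q q J * qpoch q q m * ?Y)"
      by (simp only: mult.left_commute)
    thus ?thesis unfolding * by (simp only: mult_ac)
  qed
  hence "qpoch q q J' * qpoch q q t * exchange_sum J t m x c b
      = qpoch q q J' * qpoch q q t * (qpoch_hom 0 c q m * qpoch (x * b) q J' * ?S)"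
    using exchange_sum_symmetric[OF nz JJ, of x] by simp
  hence "exchange_sum J t m x c b = qpoch_hom 0 c q m * qpoch (x * b) q J' * ?S"
    by simp
  thus ?thesis by (simp add: exchange_sum_def J'_def)
next
  case False
  have "(\<Sum>l\<le>m. qbinom q m l * qbinom q (J + l) t *
        qpoch_hom x c q l * qpoch_hom 0 x q (m - l) / qpoch (c * b) q (J + l)) = 0"
    using False by (intro sum.neutral) auto
  moreover have "(\<Sum>k\<le>t. qbinom q J k * qbinom q (J - k + m) (t - k) *
        qpoch_hom x c q (t - k) * qpoch_hom 0 x q k / qpoch (c * b) q (J - k + m)) = 0"
  proof (intro sum.neutral ballI)
    fix k
    show "qbinom q J k * qbinom q (J - k + m) (t - k) *
        qpoch_hom x c q (t - k) * qpoch_hom 0 x q k / qpoch (c * b) q (J - k + m) = 0"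
      using False by (cases "k \<le> J") auto
  qed
  ultimately show ?thesis by simp
qed

end

section \<open>Products of transfer matrices\<close>

text \<open>
  A product of matrices \<open>K r\<close>, applied to the vector \<open>1\<close>, where the index between columns \<open>r - 1\<close> and
  \<open>r\<close> runs over \<open>0, \<dots>, s r\<close>; the argument \<open>j\<close> is the free leftmost index.
\<close>

primrec transfer ::
  "nat \<Rightarrow> (nat \<Rightarrow> nat \<Rightarrow> nat \<Rightarrow> complex) \<Rightarrow> (nat \<Rightarrow> nat) \<Rightarrow> nat \<Rightarrow> complex" where
  "transfer 0 K s j = 1"
| "transfer (Suc n) K s j =
    (\<Sum>l\<le>s 1. K 0 j l * transfer n (\<lambda>r. K (Suc r)) (\<lambda>r. s (Suc r)) l)"

text \<open>
  The matrices \<open>R r\<close> are pushed through the product from right to left; at the right end the only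
  index is \<open>0\<close>, where \<open>R\<close> is trivial.
\<close>

lemma transfer_intertwine:
  assumes "\<And>r j m. r < n \<Longrightarrow> j \<le> s r \<Longrightarrow> m \<le> s (Suc r) \<Longrightarrow>
      (\<Sum>l\<le>s (Suc r). K r j l * R (Suc r) l m) = (\<Sum>k\<le>s r. R r j k * K' r k m)"
    and "s n = 0" "R n 0 0 = 1" "j \<le> s 0"
  shows "transfer n K s j = (\<Sum>k\<le>s 0. R 0 j k * transfer n K' s k)"
  using assms
proof (induction n arbitrary: K K' R s j)
  case (Suc n)
  let ?T = "transfer n (\<lambda>r. K' (Suc r)) (\<lambda>r. s (Suc r))"
  have IH: "transfer n (\<lambda>r. K (Suc r)) (\<lambda>r. s (Suc r)) l = (\<Sum>m\<le>s 1. R 1 l m * ?T m)"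
    if "l \<le> s 1" for l
    using Suc.IH[of "\<lambda>r. s (Suc r)" "\<lambda>r. K (Suc r)" "\<lambda>r. R (Suc r)" "\<lambda>r. K' (Suc r)" l]
      Suc.prems that by simp
  have "transfer (Suc n) K s j = (\<Sum>l\<le>s 1. \<Sum>m\<le>s 1. K 0 j l * R 1 l m * ?T m)"
    by (simp add: IH sum_distrib_left mult.assoc)
  also have "\<dots> = (\<Sum>m\<le>s 1. (\<Sum>l\<le>s 1. K 0 j l * R 1 l m) * ?T m)"
    by (subst sum.swap) (simp add: sum_distrib_right)
  also have "\<dots> = (\<Sum>m\<le>s 1. (\<Sum>k\<le>s 0. R 0 j k * K' 0 k m) * ?T m)"
    using Suc.prems(1)[of 0 j] Suc.prems(4) by (intro sum.cong) auto
  also have "\<dots> = (\<Sum>k\<le>s 0. R 0 j k * transfer (Suc n) K' s k)"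
    unfolding sum_distrib_right by (subst sum.swap) (simp add: sum_distrib_left mult.assoc)
  finally show ?case .
qed simp

definition bounded_seqs :: "(nat \<Rightarrow> nat) \<Rightarrow> (nat \<Rightarrow> nat) set" where
  "bounded_seqs s = {f. \<forall>r. f r \<le> s r}"

lemma bounded_seqs_split:
  "bij_betw (\<lambda>(j, f). case_nat j f) ({..s 0} \<times> bounded_seqs (\<lambda>r. s (Suc r))) (bounded_seqs s)"
  by (rule bij_betw_byWitness[where f' = "\<lambda>f. (f 0, \<lambda>r. f (Suc r))"])
     (auto simp: bounded_seqs_def fun_eq_iff split: nat.splits)

lemma finite_bounded_seqs:
  assumes "\<And>r. r \<ge> n \<Longrightarrow> s r = 0"
  shows "finite (bounded_seqs s)"
  using assms
proof (induction n arbitrary: s)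
  case 0
  hence "bounded_seqs s = {\<lambda>_. 0}" by (auto simp: bounded_seqs_def)
  thus ?case by simp
next
  case (Suc n)
  hence "finite ({..s 0} \<times> bounded_seqs (\<lambda>r. s (Suc r)))" by simp
  thus ?case using bij_betw_finite[OF bounded_seqs_split] by blast
qed

lemma transfer_expand:
  assumes "\<And>r. r > n \<Longrightarrow> s r = 0"
  shows "transfer n K s j =
    (\<Sum>f\<in>bounded_seqs (\<lambda>r. s (Suc r)). \<Prod>r<n. K r (case_nat j f r) (f r))"
  using assms
proof (induction n arbitrary: K s j)
  case 0
  have "bounded_seqs (\<lambda>r. s (Suc r)) = {\<lambda>_. 0}" using 0 by (auto simp: bounded_seqs_def)
  thus ?case by simp
next
  case (Suc n)
  have IH: "transfer n (\<lambda>r. K (Suc r)) (\<lambda>r. s (Suc r)) l =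
    (\<Sum>f\<in>bounded_seqs (\<lambda>r. s (Suc (Suc r))). \<Prod>r<n. K (Suc r) (case_nat l f r) (f r))" for l
    by (rule Suc.IH) (use Suc.prems in auto)
  have "(\<Sum>f\<in>bounded_seqs (\<lambda>r. s (Suc r)). \<Prod>r<Suc n. K r (case_nat j f r) (f r))
      = (\<Sum>(l, f)\<in>{..s 1} \<times> bounded_seqs (\<lambda>r. s (Suc (Suc r))).
          K 0 j l * (\<Prod>r<n. K (Suc r) (case_nat l f r) (f r)))"
    using sum.reindex_bij_betw[OF bounded_seqs_split[of "\<lambda>r. s (Suc r)"], symmetric,
        of "\<lambda>f. \<Prod>r<Suc n. K r (case_nat j f r) (f r)"]
    by (simp add: prod.lessThan_Suc_shift case_prod_unfold del: prod.lessThan_Suc)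
  also have "\<dots> = (\<Sum>l\<le>s 1. \<Sum>f\<in>bounded_seqs (\<lambda>r. s (Suc (Suc r))).
          K 0 j l * (\<Prod>r<n. K (Suc r) (case_nat l f r) (f r)))"
    by (rule sum.cartesian_product[symmetric])
  also have "\<dots> = transfer (Suc n) K s j"
    by (simp add: IH sum_distrib_left)
  finally show ?case ..
qed

lemma sum_transfer:
  assumes "\<And>r. r \<ge> n \<Longrightarrow> s r = 0"
  shows "(\<Sum>j\<le>s 0. transfer n K s j) = (\<Sum>f\<in>bounded_seqs s. \<Prod>r<n. K r (f r) (f (Suc r)))"
proof -
  have "(\<Sum>f\<in>bounded_seqs s. \<Prod>r<n. K r (f r) (f (Suc r)))
      = (\<Sum>(j, f)\<in>{..s 0} \<times> bounded_seqs (\<lambda>r. s (Suc r)). \<Prod>r<n. K r (case_nat j f r) (f r))"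
    unfolding sum.reindex_bij_betw[OF bounded_seqs_split, symmetric]
    by (simp add: case_prod_unfold)
  also have "\<dots> = (\<Sum>j\<le>s 0. \<Sum>f\<in>bounded_seqs (\<lambda>r. s (Suc r)). \<Prod>r<n. K r (case_nat j f r) (f r))"
    by (rule sum.cartesian_product[symmetric])
  also have "\<dots> = (\<Sum>j\<le>s 0. transfer n K s j)"
    using assms by (simp add: transfer_expand)
  finally show ?thesis ..
qed

section \<open>The two-step branching sum as a transfer matrix product\<close>

text \<open>
  The contribution of one column to \<open>skew_sqW\<close>, for a gap \<open>I = lam r - lam (r + 1)\<close> and a
  displacement \<open>j = lam r - mu r\<close>. Up to a power of \<open>d\<close> it is the \<open>q\<close>-beta-binomial weight of the
  \<open>q\<close>-Hahn process. It vanishes for \<open>j > I\<close>, so that the weights enforce interlacing by themselves.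
\<close>

definition col_weight ::
  "complex \<Rightarrow> complex \<Rightarrow> complex \<Rightarrow> complex \<Rightarrow> nat \<Rightarrow> nat \<Rightarrow> complex" where
  "col_weight q x c d I j =
    qbinom q I j * qpoch_hom x c q j * qpoch (x * d) q (I - j) / qpoch (c * d) q I"

lemma col_weight_eq_0 [simp]: "I < j \<Longrightarrow> col_weight q x c d I j = 0"
  by (simp add: col_weight_def)

lemma skew_sqW_col_weight:
  assumes "interlace mu lam"
  shows "skew_sqW q n lam mu x c d =
    (\<Prod>r<n. col_weight q x (c r) (d r) (lam r - lam (Suc r)) (lam r - mu r))"
  unfolding skew_sqW_def using assms
proof (simp, intro prod.cong refl)
  fix r
  have "lam (Suc r) \<le> mu r" "mu r \<le> lam r" using assms by (auto simp: interlace_def)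
  moreover from this have "lam r - lam (Suc r) - (lam r - mu r) = mu r - lam (Suc r)" by simp
  ultimately show "qpoch_hom x (c r) q (lam r - mu r) * qpoch (x * d r) q (mu r - lam (Suc r))
              * qpoch q q (lam r - lam (Suc r))
            / (qpoch q q (lam r - mu r) * qpoch q q (mu r - lam (Suc r))
              * qpoch (c r * d r) q (lam r - lam (Suc r)))
      = col_weight q x (c r) (d r) (lam r - lam (Suc r)) (lam r - mu r)"
    by (simp add: col_weight_def qbinom_def mult_ac)
qed

text \<open>
  A finite index set containing every partition that interlaces below \<open>lam\<close> in one or more steps;
  it allows sums over several intermediate partitions to be exchanged without following the interlacing
  conditions, which are built into \<open>skew_sqW\<close>.
\<close>

definition subpartitions :: "nat \<Rightarrow> (nat \<Rightarrow> nat) \<Rightarrow> (nat \<Rightarrow> nat) set" where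
  "subpartitions n lam = {mu \<in> partitions n. \<forall>r. mu r \<le> lam r}"

lemma finite_subpartitions:
  assumes "lam \<in> partitions n"
  shows "finite (subpartitions m lam)"
  by (rule finite_subset[OF _ finite_bounded_seqs[of n lam]])
     (use assms in \<open>auto simp: subpartitions_def partitions_def bounded_seqs_def\<close>)

text \<open>
  The intermediate partition is replaced by its displacement \<open>f r = lam r - nu r\<close>. Then the upper gap of
  the second step is \<open>nu r - nu (r + 1) = lam r - lam (r + 1) - f r + f (r + 1)\<close>, which involves two
  adjacent values of \<open>f\<close> only. Every \<open>f\<close> bounded by \<open>lam - kap\<close> may be admitted: if the
  corresponding \<open>nu\<close> does not interlace, the first or the second weight of some column is zero.
\<close>

lemma two_step_transfer:
  assumes lam: "lam \<in> partitions n" and kap: "kap \<in> subpartitions n lam"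
  shows "(\<Sum>nu\<in>subpartitions n lam. skew_sqW q n nu kap y c' d * skew_sqW q n lam nu x c d)
    = (\<Sum>j\<le>lam 0 - kap 0. transfer n (\<lambda>r j l.
        col_weight q x (c r) (d r) (lam r - lam (Suc r)) j *
        col_weight q y (c' r) (d r) (lam r - lam (Suc r) - j + l) (lam r - kap r - j))
        (\<lambda>r. lam r - kap r) j)"
proof -
  let ?s = "\<lambda>r. lam r - kap r" and ?I = "\<lambda>r. lam r - lam (Suc r)"
  let ?K = "\<lambda>r j l. col_weight q x (c r) (d r) (?I r) j *
        col_weight q y (c' r) (d r) (?I r - j + l) (?s r - j)"
  let ?B = "{f \<in> bounded_seqs ?s. interlace kap (\<lambda>r. lam r - f r) \<and> interlace (\<lambda>r. lam r - f r) lam}"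
  let ?A = "{nu \<in> subpartitions n lam. interlace kap nu \<and> interlace nu lam}"
  have kl: "kap r \<le> lam r" for r using kap by (simp add: subpartitions_def)
  have l0: "lam r = 0" if "r \<ge> n" for r using lam that by (simp add: partitions_def)
  have dec: "lam (Suc r) \<le> lam r" for r
    using lam by (auto simp: partitions_def antimono_iff_le_Suc)
  have fin: "finite (subpartitions n lam)" using lam by (rule finite_subpartitions)
  have "(\<Sum>nu\<in>subpartitions n lam. skew_sqW q n nu kap y c' d * skew_sqW q n lam nu x c d)
      = (\<Sum>nu\<in>?A. skew_sqW q n nu kap y c' d * skew_sqW q n lam nu x c d)"
    by (rule sum.mono_neutral_right[OF fin]) (auto simp: skew_sqW_def)
  also have "\<dots> = (\<Sum>f\<in>?B. \<Prod>r<n. ?K r (f r) (f (Suc r)))"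
  proof (rule sum.reindex_bij_witness[where
        i = "\<lambda>f r. lam r - f r" and j = "\<lambda>nu r. lam r - nu r"])
    fix nu assume nu: "nu \<in> ?A"
    hence nl: "nu r \<le> lam r" "kap r \<le> nu r" "nu (Suc r) \<le> kap r" for r
      by (auto simp: interlace_def)
    show eq: "(\<lambda>r. lam r - (lam r - nu r)) = nu" using nl by auto
    show "(\<lambda>r. lam r - nu r) \<in> ?B"
      using nu nl by (auto simp: bounded_seqs_def eq intro: diff_le_mono2)
    have K: "?K r (lam r - nu r) (lam (Suc r) - nu (Suc r)) =
        col_weight q y (c' r) (d r) (nu r - nu (Suc r)) (nu r - kap r) *
        col_weight q x (c r) (d r) (lam r - lam (Suc r)) (lam r - nu r)" for r
    proof -
      have "lam (Suc r) \<le> nu r" using nu by (auto simp: interlace_def)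
      hence "?I r - (lam r - nu r) + (lam (Suc r) - nu (Suc r)) = nu r - nu (Suc r)"
        "?s r - (lam r - nu r) = nu r - kap r"
        using nl[of r] nl[of "Suc r"] kl[of r] by auto
      thus ?thesis by simp
    qed
    have "skew_sqW q n nu kap y c' d * skew_sqW q n lam nu x c d =
        (\<Prod>r<n. col_weight q y (c' r) (d r) (nu r - nu (Suc r)) (nu r - kap r) *
          col_weight q x (c r) (d r) (lam r - lam (Suc r)) (lam r - nu r))"
      using nu by (simp add: skew_sqW_col_weight prod.distrib)
    thus "(\<Prod>r<n. ?K r (lam r - nu r) (lam (Suc r) - nu (Suc r)))
        = skew_sqW q n nu kap y c' d * skew_sqW q n lam nu x c d"
      by (simp only: K)
  next
    fix f assume f: "f \<in> ?B"
    hence "f r \<le> lam r - kap r" for r by (simp add: bounded_seqs_def)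
    hence "f r \<le> lam r" for r using diff_le_self order_trans by blast
    thus "(\<lambda>r. lam r - (lam r - f r)) = f" by auto
    have "antimono (\<lambda>r. lam r - f r)"
      unfolding antimono_iff_le_Suc
    proof
      fix r
      have "lam (Suc r) \<le> lam r - f r" using f by (auto simp: interlace_def)
      thus "lam (Suc r) - f (Suc r) \<le> lam r - f r" by simp
    qed
    thus "(\<lambda>r. lam r - f r) \<in> ?A"
      using f l0 by (auto simp: subpartitions_def partitions_def)
  qed
  also have "\<dots> = (\<Sum>f\<in>bounded_seqs ?s. \<Prod>r<n. ?K r (f r) (f (Suc r)))"
  proof (rule sum.mono_neutral_left)
    show "finite (bounded_seqs ?s)" using finite_bounded_seqs[of n ?s] l0 by simp
    show "\<forall>f\<in>bounded_seqs ?s - ?B. (\<Prod>r<n. ?K r (f r) (f (Suc r))) = 0"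
    proof
      fix f assume f: "f \<in> bounded_seqs ?s - ?B"
      hence fs: "f r \<le> lam r - kap r" for r by (auto simp: bounded_seqs_def)
      have "\<exists>r. f r > ?I r \<or> (f r \<le> ?I r \<and> ?I r - f r + f (Suc r) < ?s r - f r)"
      proof (rule ccontr)
        assume "\<not> ?thesis"
        hence 1: "f r \<le> ?I r" "?s r - f r \<le> ?I r - f r + f (Suc r)" for r
          by (auto simp: not_less)
        have "lam (Suc r) \<le> lam r - f r" "kap r \<le> lam r - f r" "lam (Suc r) - f (Suc r) \<le> kap r" for r
          using 1[of r] fs[of r] fs[of "Suc r"] kl[of r] kl[of "Suc r"] dec[of r] by auto
        thus False using f by (auto simp: interlace_def)
      qed
      then obtain r where r: "f r > ?I r \<or> (f r \<le> ?I r \<and> ?I r - f r + f (Suc r) < ?s r - f r)" ..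
      have "r < n"
      proof (rule ccontr)
        assume "\<not> r < n"
        thus False using r l0[of r] fs[of r] by auto
      qed
      moreover have "?K r (f r) (f (Suc r)) = 0" using r by auto
      ultimately show "(\<Prod>r<n. ?K r (f r) (f (Suc r))) = 0" by (auto intro: prod_zero)
    qed
  qed auto
  also have "\<dots> = (\<Sum>j\<le>?s 0. transfer n ?K ?s j)"
    by (rule sum_transfer[symmetric]) (use l0 in auto)
  finally show ?thesis .
qed

section \<open>Exchanging a variable with zero\<close>

context
  fixes q :: complex
  assumes q: "norm q < 1"
begin

text \<open>
  The parameters \<open>c\<close> and \<open>c'\<close> belong to adjacent columns, since the second branching step uses the
  shifted family. The left-hand kernel applies \<open>x\<close> first, the right-hand kernel \<open>0\<close> first. In the latter
  the factor \<open>H\<^sub>k(0, c)\<close> of the state \<open>k\<close> is removed and the factor \<open>H\<^sub>m(0, c')\<close> of the next state is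
  inserted. Without this change of gauge the intertwiner would contain negative powers of \<open>c\<close>, and
  \<open>c\<close> may be zero.
\<close>

lemma kernel_intertwine:
  assumes nz: "\<And>k. qpoch (c' * b) q k \<noteq> 0" and "j \<le> s" "m \<le> s'"
  shows "(\<Sum>l\<le>s'. (col_weight q x c b I j * col_weight q 0 c' b (I - j + l) (s - j)) *
        (qbinom q m l * qpoch_hom x c' q l * qpoch_hom 0 x q (m - l)))
    = (\<Sum>k\<le>s. (qbinom q k j * qpoch_hom x c q j * qpoch_hom 0 x q (k - j)) *
        (qbinom q I k / qpoch (c * b) q I * col_weight q x c' b (I - k + m) (s - k) * qpoch_hom 0 c' q m))"
    (is "?L = (\<Sum>k\<le>s. ?R k)")
proof (cases "j \<le> I")
  case True
  define J t where "J = I - j" and "t = s - j"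
  let ?p = "qbinom q I j * qpoch_hom x c q j / qpoch (c * b) q I"
  have "?L = (\<Sum>l\<le>m. (col_weight q x c b I j * col_weight q 0 c' b (J + l) t) *
        (qbinom q m l * qpoch_hom x c' q l * qpoch_hom 0 x q (m - l)))"
    unfolding J_def t_def using assms(3) by (intro sum.mono_neutral_right) auto
  also have "\<dots> = ?p * (qpoch (x * b) q J * qpoch_hom 0 c' q t *
     (\<Sum>l\<le>m. qbinom q m l * qbinom q (J + l) t *
        qpoch_hom x c' q l * qpoch_hom 0 x q (m - l) / qpoch (c' * b) q (J + l)))"
    unfolding sum_distrib_left col_weight_def J_def[symmetric] by (intro sum.cong) simp_all
  also have "\<dots> = ?p * (qpoch_hom 0 c' q m * qpoch (x * b) q (J + m - t) *
     (\<Sum>k\<le>t. qbinom q J k * qbinom q (J - k + m) (t - k) *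
        qpoch_hom x c' q (t - k) * qpoch_hom 0 x q k / qpoch (c' * b) q (J - k + m)))"
    unfolding column_exchange[OF q nz] ..
  also have "\<dots> = (\<Sum>k\<le>t. ?R (k + j))"
    unfolding sum_distrib_left
  proof (rule sum.cong[OF refl])
    fix k assume k: "k \<in> {..t}"
    show "?p * (qpoch_hom 0 c' q m * qpoch (x * b) q (J + m - t) *
       (qbinom q J k * qbinom q (J - k + m) (t - k) *
        qpoch_hom x c' q (t - k) * qpoch_hom 0 x q k / qpoch (c' * b) q (J - k + m))) = ?R (k + j)"
    proof (cases "k \<le> J")
      case True
      have "qbinom q (k + j) j * qbinom q I (k + j) = qbinom q I j * qbinom q J k"
        using qbinom_mult_qbinom[OF q, of j "k + j" I] True \<open>j \<le> I\<close>
        by (simp add: J_def mult.commute)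
      moreover have "I - (k + j) = J - k" "s - (k + j) = t - k" by (auto simp: J_def t_def)
      moreover have "J - k + m - (t - k) = J + m - t" using True k by auto
      ultimately show ?thesis by (simp add: col_weight_def)
    next
      case False
      hence "I < k + j" by (auto simp: J_def)
      thus ?thesis using False by simp
    qed
  qed
  also have "\<dots> = (\<Sum>k\<in>{j..s}. ?R k)"
    using sum.shift_bounds_cl_nat_ivl[of ?R 0 j t] assms(2) by (simp add: t_def atLeast0AtMost)
  also have "\<dots> = (\<Sum>k\<le>s. ?R k)"
    by (rule sum.mono_neutral_left) auto
  finally show ?thesis .
next
  case False
  have "?R k = 0" for k using False by (cases "k < j") auto
  hence "(\<Sum>k\<le>s. ?R k) = 0" by (simp only: sum.neutral_const)
  moreover have "?L = 0" using False by simp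
  ultimately show ?thesis by simp
qed

text \<open>
  The column sums of the intertwiner restore the factor that the change of gauge removes from the leftmost
  column.
\<close>

lemma qpoch_hom_sum:
  "(\<Sum>l\<le>m. qbinom q m l * qpoch_hom x c q l * qpoch_hom 0 x q (m - l)) = qpoch_hom 0 c q m"
  using q_Chu_Vandermonde[OF q, of c 0 m x] by simp

text \<open>
  Both products are compared with the product of the kernels \<open>K'\<close> in the changed gauge: the first one
  by the intertwiner \<open>R\<close>, the second one by the diagonal matrix \<open>D\<close>.
\<close>

lemma transfer_exchange:
  assumes nz: "\<And>r k. r < n \<Longrightarrow> qpoch (c (Suc r) * d r) q k \<noteq> 0" and s: "s n = 0"
  shows "(\<Sum>j\<le>s 0. transfer n (\<lambda>r j l.
        col_weight q x (c r) (d r) (I r) j *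
        col_weight q 0 (c (Suc r)) (d r) (I r - j + l) (s r - j)) s j)
    = (\<Sum>j\<le>s 0. transfer n (\<lambda>r j l.
        col_weight q 0 (c r) (d r) (I r) j *
        col_weight q x (c (Suc r)) (d r) (I r - j + l) (s r - j)) s j)"
proof -
  let ?K' = "\<lambda>r k m. qbinom q (I r) k / qpoch (c r * d r) q (I r) *
      col_weight q x (c (Suc r)) (d r) (I r - k + m) (s r - k) * qpoch_hom 0 (c (Suc r)) q m"
  let ?R = "\<lambda>r j k. qbinom q k j * qpoch_hom x (c r) q j * qpoch_hom 0 x q (k - j)"
  let ?D = "\<lambda>r j k. if k = j then qpoch_hom 0 (c r) q j else 0"
  have 1: "transfer n (\<lambda>r j l. col_weight q x (c r) (d r) (I r) j *
        col_weight q 0 (c (Suc r)) (d r) (I r - j + l) (s r - j)) s j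
      = (\<Sum>k\<le>s 0. ?R 0 j k * transfer n ?K' s k)" if "j \<le> s 0" for j
    by (rule transfer_intertwine)
       (use that s kernel_intertwine[OF nz] in \<open>auto simp: qbinom_0[OF q]\<close>)
  have 2: "transfer n (\<lambda>r j l. col_weight q 0 (c r) (d r) (I r) j *
        col_weight q x (c (Suc r)) (d r) (I r - j + l) (s r - j)) s j
      = (\<Sum>k\<le>s 0. ?D 0 j k * transfer n ?K' s k)" if "j \<le> s 0" for j
    by (rule transfer_intertwine)
       (use that s in \<open>auto simp: col_weight_def if_distrib if_distribR cong: if_cong\<close>)
  have "(\<Sum>j\<le>s 0. \<Sum>k\<le>s 0. ?R 0 j k * transfer n ?K' s k)
      = (\<Sum>k\<le>s 0. (\<Sum>j\<le>s 0. ?R 0 j k) * transfer n ?K' s k)"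
    by (subst sum.swap) (simp add: sum_distrib_right)
  also have "\<dots> = (\<Sum>k\<le>s 0. qpoch_hom 0 (c 0) q k * transfer n ?K' s k)"
  proof (rule sum.cong[OF refl])
    fix k assume "k \<in> {..s 0}"
    hence "(\<Sum>j\<le>s 0. ?R 0 j k) = (\<Sum>j\<le>k. ?R 0 j k)"
      by (intro sum.mono_neutral_right) auto
    thus "(\<Sum>j\<le>s 0. ?R 0 j k) * transfer n ?K' s k = qpoch_hom 0 (c 0) q k * transfer n ?K' s k"
      by (simp add: qpoch_hom_sum)
  qed
  finally show ?thesis
    by (simp add: 1 2 if_distrib if_distribR cong: if_cong)
qed

text \<open>
  The two-variable skew functions are symmetric in their variables when one of these is zero. Since
  \<open>lam\<close> and \<open>kap\<close> have at most \<open>n\<close> parts, no displacement is left in column \<open>n\<close>, which is what ends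
  the transfer matrix product in a trivial state.
\<close>

lemma skew_exchange:
  assumes lam: "lam \<in> partitions n" and kap: "kap \<in> partitions n"
    and nz: "\<And>r k. r < n \<Longrightarrow> qpoch (c (Suc r) * d r) q k \<noteq> 0"
  shows "(\<Sum>nu\<in>subpartitions n lam. skew_sqW q n nu kap 0 (\<lambda>r. c (Suc r)) d * skew_sqW q n lam nu x c d)
    = (\<Sum>mu\<in>subpartitions n lam. skew_sqW q n mu kap x (\<lambda>r. c (Suc r)) d * skew_sqW q n lam mu 0 c d)"
proof (cases "\<forall>r. kap r \<le> lam r")
  case True
  hence kap': "kap \<in> subpartitions n lam" using kap by (simp add: subpartitions_def)
  have "lam n - kap n = 0" using lam by (simp add: partitions_def)
  thus ?thesis
    unfolding two_step_transfer[OF lam kap'] by (intro transfer_exchange nz)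
next
  case False
  have "\<not> interlace kap nu" if "nu \<in> subpartitions n lam" for nu
    using that False order_trans by (fastforce simp: interlace_def subpartitions_def)
  thus ?thesis by (simp add: skew_sqW_def)
qed

end

section \<open>Setting a variable to zero\<close>

lemma skew_sqW_Suc:
  assumes "lam \<in> partitions n" "mu \<in> partitions n"
  shows "skew_sqW q (Suc n) lam mu x c d = skew_sqW q n lam mu x c d"
  using assms by (simp add: skew_sqW_def partitions_def)

lemma sqW_Suc_subpartitions:
  assumes "lam \<in> partitions n" "\<And>r. mu r \<le> lam r"
  shows "sqW q (Suc N) mu x c d = (\<Sum>kap\<in>subpartitions N lam.
    sqW q N kap x (\<lambda>r. c (Suc r)) d * skew_sqW q (Suc N) mu kap (x N) c d)"
  unfolding sqW.simps
proof (rule sum.mono_neutral_left)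
  show "finite (subpartitions N lam)" using assms(1) by (rule finite_subpartitions)
  show "{kap. kap \<in> partitions N \<and> interlace kap mu} \<subseteq> subpartitions N lam"
    using assms(2) order_trans by (fastforce simp: subpartitions_def interlace_def)
qed (auto simp: skew_sqW_def subpartitions_def)

lemma subpartitions_subset:
  assumes "m \<le> n" shows "subpartitions m lam \<subseteq> subpartitions n lam"
  using partitions_mono[OF assms] by (auto simp: subpartitions_def)

lemma partitions_SucD: "lam \<in> partitions (Suc n) \<Longrightarrow> lam n = 0 \<Longrightarrow> lam \<in> partitions n"
  by (auto simp: partitions_def) (metis le_antisym not_less_eq_eq)

lemma skew_sqW_eq_0:
  assumes "lam \<in> partitions (Suc n)" "mu \<in> partitions n" "lam n > 0" "c n = 0"
  shows "skew_sqW q (Suc n) lam mu 0 c d = 0"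
  using assms by (simp add: skew_sqW_def partitions_def qpoch_hom_zero_zero)

text \<open>
  If \<open>x\<^sub>i\<close> is the last variable, its skew factor contains \<open>0 ^ lam n\<close>. Otherwise interlacing gives
  \<open>mu (n - 1) \<ge> lam n > 0\<close> for every \<open>mu\<close> in the branching rule, and the shift of the parameters keeps
  the last one equal to zero.
\<close>

lemma sqW_eq_0:
  assumes "lam \<in> partitions (Suc n)" "lam n > 0" "c n = 0" "i \<le> n" "x i = 0"
  shows "sqW q (Suc n) lam x c d = 0"
  using assms
proof (induction n arbitrary: lam c)
  case 0
  hence "skew_sqW q (Suc 0) lam mu (x 0) c d = 0" if "mu \<in> partitions 0" for mu
    using skew_sqW_eq_0[of lam 0 mu c] that by simp
  thus ?case by (auto intro!: sum.neutral)
next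
  case (Suc n)
  show ?case
    unfolding sqW.simps(2)[of q "Suc n"]
  proof (intro sum.neutral ballI)
    fix mu assume mu: "mu \<in> {mu. mu \<in> partitions (Suc n) \<and> interlace mu lam}"
    show "sqW q (Suc n) mu x (\<lambda>r. c (Suc r)) d * skew_sqW q (Suc (Suc n)) lam mu (x (Suc n)) c d = 0"
    proof (cases "i = Suc n")
      case True
      thus ?thesis using skew_sqW_eq_0[of lam "Suc n" mu c] Suc.prems mu by simp
    next
      case False
      have "lam (Suc n) \<le> mu n" using mu by (auto simp: interlace_def)
      hence "sqW q (Suc n) mu x (\<lambda>r. c (Suc r)) d = 0"
        using mu Suc.prems False by (intro Suc.IH) auto
      thus ?thesis by simp
    qed
  qed
qed

text \<open>
  Two branching steps are expanded, \<open>lam\<close> to \<open>mu\<close> with variable \<open>0\<close> and \<open>mu\<close> to \<open>kap\<close> with variable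
  \<open>x\<^bsub>n-1\<^esub>\<close>, and exchanged. Since the last parameter of the inner step is \<open>0\<close>, the zero variable now
  forces the intermediate partition to have at most \<open>n - 1\<close> parts, so that the induction hypothesis
  applies to the inner sum.
\<close>

lemma sqW_last_zero:
  assumes q: "norm q < 1" and c: "\<And>r. r < n \<Longrightarrow> norm (c r) < 1" and d: "\<And>r. r < n \<Longrightarrow> norm (d r) < 1"
    and "lam \<in> partitions n" "c n = 0" "x n = 0"
  shows "sqW q (Suc n) lam x c d = sqW q n lam x c d"
  using c d assms(4-)
proof (induction n arbitrary: lam c x)
  case 0
  have "{mu. mu \<in> partitions 0 \<and> interlace mu lam} = {\<lambda>_. 0}"
    using 0 by (auto simp: partitions_def interlace_def)
  hence "sqW q (Suc 0) lam x c d = skew_sqW q (Suc 0) lam (\<lambda>_. 0) (x 0) c d"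
    by (simp only: sqW.simps) simp
  thus ?case using 0 by (simp add: skew_sqW_def partitions_def interlace_def)
next
  case (Suc n)
  let ?S = "subpartitions (Suc n) lam" and ?T = "subpartitions n lam"
  let ?c = "\<lambda>r. c (Suc r)" and ?cc = "\<lambda>r. c (Suc (Suc r))"
  note lam = \<open>lam \<in> partitions (Suc n)\<close>
  have S: "mu \<in> partitions (Suc n)" "mu r \<le> lam r" if "mu \<in> ?S" for mu r
    using that by (auto simp: subpartitions_def)
  have T: "?T \<subseteq> ?S" by (rule subpartitions_subset) simp
  have nz: "qpoch (c (Suc r) * d r) q k \<noteq> 0" if "r < Suc n" for r k
  proof (rule qpoch_nonzero[OF q])
    have "norm (c (Suc r)) < 1" using Suc.prems that by (cases "r = n") auto
    thus "norm (c (Suc r) * d r) < 1"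
      using Suc.prems(2)[OF that] mult_strict_mono'[of "norm (c (Suc r))" 1 "norm (d r)" 1]
      by (simp add: norm_mult)
  qed
  have "sqW q (Suc (Suc n)) lam x c d
      = (\<Sum>mu\<in>?S. sqW q (Suc n) mu x ?c d * skew_sqW q (Suc n) lam mu 0 c d)"
    unfolding sqW_Suc_subpartitions[OF lam order.refl]
    using Suc.prems S lam by (intro sum.cong refl) (simp add: skew_sqW_Suc)
  also have "\<dots> = (\<Sum>mu\<in>?S. \<Sum>kap\<in>?T. sqW q n kap x ?cc d *
      (skew_sqW q (Suc n) mu kap (x n) ?c d * skew_sqW q (Suc n) lam mu 0 c d))"
  proof (rule sum.cong[OF refl])
    fix mu assume mu: "mu \<in> ?S"
    show "sqW q (Suc n) mu x ?c d * skew_sqW q (Suc n) lam mu 0 c d = (\<Sum>kap\<in>?T. sqW q n kap x ?cc d *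
      (skew_sqW q (Suc n) mu kap (x n) ?c d * skew_sqW q (Suc n) lam mu 0 c d))"
      unfolding sqW_Suc_subpartitions[OF lam S(2)[OF mu]] sum_distrib_right mult.assoc ..
  qed
  also have "\<dots> = (\<Sum>kap\<in>?T. sqW q n kap x ?cc d *
      (\<Sum>mu\<in>?S. skew_sqW q (Suc n) mu kap (x n) ?c d * skew_sqW q (Suc n) lam mu 0 c d))"
    by (subst sum.swap) (simp only: sum_distrib_left)
  also have "\<dots> = (\<Sum>kap\<in>?T. sqW q n kap x ?cc d *
      (\<Sum>nu\<in>?S. skew_sqW q (Suc n) nu kap 0 ?c d * skew_sqW q (Suc n) lam nu (x n) c d))"
  proof (rule sum.cong[OF refl], rule arg_cong2[of _ _ _ _ "(*)", OF refl])
    fix kap assume "kap \<in> ?T"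
    hence kap: "kap \<in> partitions (Suc n)" using T S by blast
    show "(\<Sum>mu\<in>?S. skew_sqW q (Suc n) mu kap (x n) ?c d * skew_sqW q (Suc n) lam mu 0 c d)
      = (\<Sum>nu\<in>?S. skew_sqW q (Suc n) nu kap 0 ?c d * skew_sqW q (Suc n) lam nu (x n) c d)"
      by (rule skew_exchange[OF q lam kap, where c = c and d = d, OF nz, symmetric])
  qed
  also have "\<dots> = (\<Sum>kap\<in>?T. sqW q n kap x ?cc d *
      (\<Sum>nu\<in>?T. skew_sqW q n nu kap 0 ?c d * skew_sqW q (Suc n) lam nu (x n) c d))"
  proof (rule sum.cong[OF refl], rule arg_cong2[of _ _ _ _ "(*)", OF refl])
    fix kap assume kap: "kap \<in> ?T"
    have "(\<Sum>nu\<in>?S. skew_sqW q (Suc n) nu kap 0 ?c d * skew_sqW q (Suc n) lam nu (x n) c d)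
      = (\<Sum>nu\<in>?T. skew_sqW q (Suc n) nu kap 0 ?c d * skew_sqW q (Suc n) lam nu (x n) c d)"
    proof (rule sum.mono_neutral_right[OF finite_subpartitions[OF lam] T], intro ballI)
      fix nu assume nu: "nu \<in> ?S - ?T"
      hence "nu n \<noteq> 0" using partitions_SucD by (auto simp: subpartitions_def)
      thus "skew_sqW q (Suc n) nu kap 0 ?c d * skew_sqW q (Suc n) lam nu (x n) c d = 0"
        using nu kap Suc.prems by (simp add: skew_sqW_eq_0 subpartitions_def)
    qed
    thus "(\<Sum>nu\<in>?S. skew_sqW q (Suc n) nu kap 0 ?c d * skew_sqW q (Suc n) lam nu (x n) c d)
      = (\<Sum>nu\<in>?T. skew_sqW q n nu kap 0 ?c d * skew_sqW q (Suc n) lam nu (x n) c d)"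
      using kap by (simp add: skew_sqW_Suc subpartitions_def)
  qed
  also have "\<dots> = (\<Sum>nu\<in>?T. (\<Sum>kap\<in>?T. sqW q n kap x ?cc d * skew_sqW q n nu kap 0 ?c d)
      * skew_sqW q (Suc n) lam nu (x n) c d)"
    unfolding sum_distrib_left sum_distrib_right by (subst sum.swap) (simp only: mult.assoc)
  also have "\<dots> = (\<Sum>nu\<in>?T. sqW q n nu x ?c d * skew_sqW q (Suc n) lam nu (x n) c d)"
  proof (intro sum.cong refl arg_cong2[of _ _ _ _ "(*)"])
    fix nu assume nu: "nu \<in> ?T"
    \<comment> \<open>The inner sum is the branching rule for a polynomial whose last variable is zero.\<close>
    let ?x = "x(n := 0)"
    have "(\<Sum>kap\<in>?T. sqW q n kap x ?cc d * skew_sqW q n nu kap 0 ?c d)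
        = (\<Sum>kap\<in>?T. sqW q n kap ?x ?cc d * skew_sqW q (Suc n) nu kap (?x n) ?c d)"
      using nu by (intro sum.cong refl arg_cong2[of _ _ _ _ "(*)"] sqW_cong)
        (auto simp: skew_sqW_Suc subpartitions_def)
    also have "\<dots> = sqW q (Suc n) nu ?x ?c d"
      using nu by (intro sqW_Suc_subpartitions[OF lam, symmetric]) (simp add: subpartitions_def)
    also have "\<dots> = sqW q n nu ?x ?c d"
      using nu Suc.prems by (intro Suc.IH) (auto simp: subpartitions_def)
    also have "\<dots> = sqW q n nu x ?c d" by (rule sqW_cong) auto
    finally show "(\<Sum>kap\<in>?T. sqW q n kap x ?cc d * skew_sqW q n nu kap 0 ?c d) = sqW q n nu x ?c d" .
  qed
  also have "\<dots> = sqW q (Suc n) lam x c d"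
    by (rule sqW_Suc_subpartitions[OF lam order.refl, symmetric])
  finally show ?case .
qed

text \<open>
  For \<open>i\<close> below the last position the partitions \<open>mu\<close> with the maximal number of parts drop out by
  \<open>sqW_eq_0\<close>, and the remaining ones are covered by the induction hypothesis.
\<close>

lemma sqW_drop_zero:
  assumes q: "norm q < 1" and c: "\<And>r. r < n \<Longrightarrow> norm (c r) < 1" and d: "\<And>r. r < n \<Longrightarrow> norm (d r) < 1"
    and "lam \<in> partitions n" "c n = 0" "i \<le> n" "x i = 0"
  shows "sqW q (Suc n) lam x c d = sqW q n lam (\<lambda>j. if j < i then x j else x (Suc j)) c d"
  using c d assms(4-)
proof (induction n arbitrary: lam c)
  case 0
  thus ?case using sqW_last_zero[OF q, of 0 c d lam x] by simp
next
  case (Suc n)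
  let ?x = "\<lambda>j. if j < i then x j else x (Suc j)" and ?c = "\<lambda>r. c (Suc r)"
  note lam = \<open>lam \<in> partitions (Suc n)\<close>
  let ?S = "subpartitions (Suc n) lam" and ?T = "subpartitions n lam"
  show ?case
  proof (cases "i = Suc n")
    case True
    hence "sqW q (Suc (Suc n)) lam x c d = sqW q (Suc n) lam x c d"
      using Suc.prems by (intro sqW_last_zero q) auto
    also have "\<dots> = sqW q (Suc n) lam ?x c d"
      by (rule sqW_cong) (use True in auto)
    finally show ?thesis .
  next
    case False
    hence i: "i \<le> n" using Suc.prems by simp
    have "sqW q (Suc (Suc n)) lam x c d
      = (\<Sum>mu\<in>?S. sqW q (Suc n) mu x ?c d * skew_sqW q (Suc (Suc n)) lam mu (x (Suc n)) c d)"
      by (rule sqW_Suc_subpartitions[OF lam order.refl])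
    also have "\<dots> = (\<Sum>mu\<in>?T. sqW q (Suc n) mu x ?c d * skew_sqW q (Suc (Suc n)) lam mu (x (Suc n)) c d)"
    proof (rule sum.mono_neutral_right[OF finite_subpartitions[OF lam]])
      show "?T \<subseteq> ?S" by (rule subpartitions_subset) simp
      show "\<forall>mu\<in>?S - ?T. sqW q (Suc n) mu x ?c d * skew_sqW q (Suc (Suc n)) lam mu (x (Suc n)) c d = 0"
      proof
        fix mu assume mu: "mu \<in> ?S - ?T"
        hence "mu n \<noteq> 0" using partitions_SucD by (auto simp: subpartitions_def)
        hence "sqW q (Suc n) mu x ?c d = 0"
          using mu Suc.prems i by (intro sqW_eq_0) (auto simp: subpartitions_def)
        thus "sqW q (Suc n) mu x ?c d * skew_sqW q (Suc (Suc n)) lam mu (x (Suc n)) c d = 0"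
          by simp
      qed
    qed
    also have "\<dots> = (\<Sum>mu\<in>?T. sqW q n mu ?x ?c d * skew_sqW q (Suc n) lam mu (?x n) c d)"
    proof (intro sum.cong refl arg_cong2[of _ _ _ _ "(*)"])
      fix mu assume mu: "mu \<in> ?T"
      thus "sqW q (Suc n) mu x ?c d = sqW q n mu ?x ?c d"
        using Suc.prems i by (intro Suc.IH) (auto simp: subpartitions_def)
      have "mu \<in> partitions (Suc n)"
        using mu partitions_mono[of n "Suc n"] by (auto simp: subpartitions_def)
      thus "skew_sqW q (Suc (Suc n)) lam mu (x (Suc n)) c d = skew_sqW q (Suc n) lam mu (?x n) c d"
        using lam i by (simp add: skew_sqW_Suc)
    qed
    also have "\<dots> = sqW q (Suc n) lam ?x c d"
      by (rule sqW_Suc_subpartitions[OF lam order.refl, symmetric])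
    finally show ?thesis .
  qed
qed

theorem proposition2p1:
  fixes q :: complex and n i :: nat and a b x :: "nat \<Rightarrow> complex" and lam :: "nat \<Rightarrow> nat"
  assumes "norm q < 1" and "n \<ge> 1"
    and "\<And>r. r < n \<Longrightarrow> norm (a r) < 1" and "\<And>r. r < n \<Longrightarrow> norm (b r) < 1"
    and "lam \<in> partitions n" and "i \<le> n"
  shows "sqWf q (n + 1) lam (x(i := 0)) a b =
    sqW q n lam (\<lambda>j. if j < i then x j else x (j + 1)) a b"
proof -
  have "sqWf q (n + 1) lam (x(i := 0)) a b = sqW q (Suc n) lam (x(i := 0)) (a(n := 0)) b"
    by (simp add: sqWf_def)
  also have "\<dots> = sqW q n lam (\<lambda>j. if j < i then (x(i := 0)) j else (x(i := 0)) (Suc j)) (a(n := 0)) b"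
    using assms by (intro sqW_drop_zero) auto
  also have "\<dots> = sqW q n lam (\<lambda>j. if j < i then x j else x (j + 1)) a b"
    by (rule sqW_cong) auto
  finally show ?thesis .
qed

end
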